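(* Let $n\ge 1$, let $\Omega$ be a finite subset of $\mathbb{Z}^n$, and let $\lambda_i$ be the $i$-th eigenvalue of the Dirichlet Laplacian on $\Omega$. Then for any $1\leq k\leq \sharp\Omega-1$, $$\sum_{i=1}^k\frac{\lambda_i}{\lambda_{k+1}-\lambda_i}\geq \frac{n}{4}\sum_{i=1}^k(1-\lambda_i),$$ where the left-hand side is to be interpreted as infinity if $\lambda_{k+1}=\lambda_k$.
   Context: $\mathbb{Z}^n$ denotes the integer lattice graph: vertex set $\mathbb{Z}^n$, with $x\sim y$ (neighbors) iff $\sum_{i=1}^n|x_i-y_i|=1$; every vertex has degree $d_x=2n$. The discrete Laplacian is $\Delta f(x)=\frac{1}{d_x}\sum_{y\sim x}f(y)-f(x)$ for $f:\mathbb{Z}^n\to\mathbb{R}$. For a finite subset $\Omega\subset\mathbb{Z}^n$ and $f:\Omega\to\mathbb{R}$, the Dirichlet Laplacian is $\Delta_\Omega f(x)=\Delta\widetilde f(x)$ for $x\in\Omega$, where $\widetilde f$ is the extension of $f$ by $0$ to $\mathbb{Z}^n$. It is self-adjoint on functions on $\Omega$ with inner product $\langle f,g\rangle=\sum_{x\in\Omega}f(x)g(x)d_x$. The eigenvalues of the Dirichlet Laplacian on $\Omega$ are the eigenvalues of $-\Delta_\Omega$, listed in non-decreasing order with multiplicity: $0<\lambda_1\le\lambda_2\le\cdots\le\lambda_N\le 2$, where $N=\sharp\Omega$ is the number of vertices of $\Omega$. *)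

theory Defs
  imports "HOL-Analysis.Finite_Cartesian_Product" "HOL-Library.Function_Algebras"
    "HOL-Library.Extended_Real"
begin

text \<open>The lattice \<open>\<int>\<^sup>n\<close> is the type \<open>int ^ 'n\<close> with \<open>n = CARD('n)\<close>, so \<open>n \<ge> 1\<close> holds automatically.\<close>

definition adjacent :: "int ^ 'n \<Rightarrow> int ^ 'n \<Rightarrow> bool"
  where "adjacent x y \<longleftrightarrow> (\<Sum>i\<in>UNIV. \<bar>x $ i - y $ i\<bar>) = 1"

definition vertex_degree :: "int ^ 'n \<Rightarrow> nat"
  where "vertex_degree x = card {y. adjacent x y}"

definition laplacian :: "(int ^ 'n \<Rightarrow> real) \<Rightarrow> int ^ 'n \<Rightarrow> real"
  where "laplacian f x =
    1 / real (vertex_degree x) * (\<Sum>y | adjacent x y. f y) - f x"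

definition extend_by_zero :: "(int ^ 'n) set \<Rightarrow> (int ^ 'n \<Rightarrow> real) \<Rightarrow> int ^ 'n \<Rightarrow> real"
  where "extend_by_zero \<Omega> f = (\<lambda>x. if x \<in> \<Omega> then f x else 0)"

text \<open>The values at points outside \<open>\<Omega>\<close> are not meaningful.\<close>

definition dirichlet_laplacian ::
    "(int ^ 'n) set \<Rightarrow> (int ^ 'n \<Rightarrow> real) \<Rightarrow> int ^ 'n \<Rightarrow> real"
  where "dirichlet_laplacian \<Omega> f x = laplacian (extend_by_zero \<Omega> f) x"

text \<open>A function \<open>\<Omega> \<rightarrow> \<real>\<close> is represented by the total function that agrees with it
  on \<open>\<Omega>\<close> and vanishes elsewhere; without this normalisation the dimension of an eigenspace
  would be wrong.\<close>

definition dirichlet_eigenspace :: "(int ^ 'n) set \<Rightarrow> real \<Rightarrow> (int ^ 'n \<Rightarrow> real) set"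
  where "dirichlet_eigenspace \<Omega> \<mu> =
    {f. (\<forall>x. x \<notin> \<Omega> \<longrightarrow> f x = 0) \<and> (\<forall>x\<in>\<Omega>. - dirichlet_laplacian \<Omega> f x = \<mu> * f x)}"

definition dirichlet_spectrum :: "(int ^ 'n) set \<Rightarrow> real set"
  where "dirichlet_spectrum \<Omega> = {\<mu>. \<exists>f\<in>dirichlet_eigenspace \<Omega> \<mu>. f \<noteq> (\<lambda>x. 0)}"

definition fun_scale :: "real \<Rightarrow> ('a \<Rightarrow> real) \<Rightarrow> 'a \<Rightarrow> real"
  where "fun_scale c f = (\<lambda>x. c * f x)"

interpretation real_fun: vector_space fun_scale
  by unfold_locales (auto simp: fun_scale_def algebra_simps)

text \<open>Since the operator is self-adjoint, geometric and algebraic multiplicities coincide.\<close>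

definition dirichlet_multiplicity :: "(int ^ 'n) set \<Rightarrow> real \<Rightarrow> nat"
  where "dirichlet_multiplicity \<Omega> \<mu> = real_fun.dim (dirichlet_eigenspace \<Omega> \<mu>)"

text \<open>All eigenvalues in non-decreasing order, each repeated according to its multiplicity.
  For finite \<open>\<Omega>\<close> the spectrum is finite and the list has length \<open>card \<Omega>\<close>.\<close>

definition dirichlet_eigenvalue_list :: "(int ^ 'n) set \<Rightarrow> real list"
  where "dirichlet_eigenvalue_list \<Omega> =
    concat (map (\<lambda>\<mu>. replicate (dirichlet_multiplicity \<Omega> \<mu>) \<mu>)
      (sorted_list_of_set (dirichlet_spectrum \<Omega>)))"

text \<open>Indexed from 1: only \<open>1 \<le> i \<le> card \<Omega>\<close> is meaningful.\<close>

definition dirichlet_eigenvalue :: "(int ^ 'n) set \<Rightarrow> nat \<Rightarrow> real"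
  where "dirichlet_eigenvalue \<Omega> i = dirichlet_eigenvalue_list \<Omega> ! (i - 1)"

end

theory Submission
  imports Defs "HOL-Analysis.Function_Topology" "HOL-Library.Multiset"
begin

text \<open>
  Let \<open>H = - \<Delta>\<^sub>\<Omega>\<close> with orthonormal eigenfunctions \<open>u\<^sub>j\<close>, let \<open>g\<close> be a coordinate function and
  \<open>G\<^sub>i\<^sub>j = \<langle>g u\<^sub>i, u\<^sub>j\<rangle>\<close>. Then \<open>\<langle>[g, [H, g]] u\<^sub>i, u\<^sub>i\<rangle> = 2 \<Sum>\<^sub>j (\<lambda>\<^sub>j - \<lambda>\<^sub>i) G\<^sub>i\<^sub>j\<^sup>2\<close> and
  \<open>\<parallel>[H, g] u\<^sub>i\<parallel>\<^sup>2 = \<Sum>\<^sub>j (\<lambda>\<^sub>j - \<lambda>\<^sub>i)\<^sup>2 G\<^sub>i\<^sub>j\<^sup>2\<close>. Summing the first identity over \<open>i \<le> k\<close>, the terms with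
  \<open>j \<le> k\<close> cancel, and for \<open>j > k\<close> one has \<open>\<lambda>\<^sub>j - \<lambda>\<^sub>i \<le> (\<lambda>\<^sub>j - \<lambda>\<^sub>i)\<^sup>2 / (\<lambda>\<^sub>k\<^sub>+\<^sub>1 - \<lambda>\<^sub>i)\<close>.
  On the lattice \<open>[H, g]\<close> is a central difference and \<open>[g, [H, g]]\<close> the averaging operator in one
  direction, so summation over the \<open>n\<close> coordinates turns the left-hand side into \<open>1 - \<lambda>\<^sub>i\<close> and bounds
  \<open>\<parallel>[H, g] u\<^sub>i\<parallel>\<^sup>2\<close> by \<open>2 \<lambda>\<^sub>i / n\<close>.
\<close>

section \<open>Pointwise sums of functions and lists with repeated entries\<close>

lemma sum_fun_apply: "(\<Sum>i\<in>I. f i) x = (\<Sum>i\<in>I. f i x)"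
  for f :: "'i \<Rightarrow> 'a \<Rightarrow> real"
  by (induction I rule: infinite_finite_induct) auto

lemma sorted_concat_replicate:
  "sorted xs \<Longrightarrow> sorted (concat (map (\<lambda>x. replicate (m x) x) xs))"
  for xs :: "real list"
  by (induction xs) (auto simp: sorted_append)

lemma count_concat_replicate:
  "distinct xs \<Longrightarrow> count (mset (concat (map (\<lambda>x. replicate (m x) x) xs))) y
     = (if y \<in> set xs then m y else 0)"
  by (induction xs) auto

section \<open>Symmetric kernels on finite sets\<close>

locale symmetric_kernel =
  fixes \<Omega> :: "'a set" and K :: "'a \<Rightarrow> 'a \<Rightarrow> real"
  assumes finite_dom: "finite \<Omega>"
    and kernel_sym: "x \<in> \<Omega> \<Longrightarrow> y \<in> \<Omega> \<Longrightarrow> K x y = K y x"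
begin

definition supported :: "('a \<Rightarrow> real) set"
  where "supported = {f. \<forall>x. x \<notin> \<Omega> \<longrightarrow> f x = 0}"

text \<open>No degree weight appears: on the lattice all degrees are equal, so the weighted inner
  product is a constant multiple of this one and has the same orthogonality relations.\<close>

definition ip :: "('a \<Rightarrow> real) \<Rightarrow> ('a \<Rightarrow> real) \<Rightarrow> real"
  where "ip f g = (\<Sum>x\<in>\<Omega>. f x * g x)"

text \<open>The cut-off outside \<Omega> lets the eigenvalue equation be stated between total
  functions.\<close>

definition app :: "('a \<Rightarrow> real) \<Rightarrow> 'a \<Rightarrow> real"
  where "app f = (\<lambda>x. if x \<in> \<Omega> then \<Sum>y\<in>\<Omega>. K x y * f y else 0)"

definition eigen :: "real \<Rightarrow> ('a \<Rightarrow> real) set"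
  where "eigen \<mu> = {f \<in> supported. app f = (\<lambda>x. \<mu> * f x)}"

definition orthonormal :: "('a \<Rightarrow> real) set \<Rightarrow> bool"
  where "orthonormal B \<longleftrightarrow> B \<subseteq> supported \<and> (\<forall>b\<in>B. \<forall>c\<in>B. ip b c = (if b = c then 1 else 0))"

lemma ip_commute: "ip f g = ip g f"
  by (simp add: ip_def mult.commute)

lemma ip_add_left: "ip (\<lambda>x. f x + g x) h = ip f h + ip g h"
  by (simp add: ip_def algebra_simps sum.distrib)

lemma ip_diff_left: "ip (\<lambda>x. f x - g x) h = ip f h - ip g h"
  by (simp add: ip_def algebra_simps sum_subtractf)

lemma ip_scale_left: "ip (\<lambda>x. c * f x) h = c * ip f h"
  by (simp add: ip_def algebra_simps sum_distrib_left)

lemma ip_sum_left: "ip (\<lambda>x. \<Sum>i\<in>I. f i x) h = (\<Sum>i\<in>I. ip (f i) h)"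
  unfolding ip_def sum_distrib_right by (rule sum.swap)

lemma ip_add_right: "ip h (\<lambda>x. f x + g x) = ip h f + ip h g"
  by (simp add: ip_def algebra_simps sum.distrib)

lemma ip_scale_right: "ip h (\<lambda>x. c * f x) = c * ip h f"
  by (simp add: ip_def algebra_simps sum_distrib_left)

lemma ip_self_nonneg: "0 \<le> ip f f"
  by (simp add: ip_def sum_nonneg)

lemma ip_self_eq_0: "f \<in> supported \<Longrightarrow> ip f f = 0 \<Longrightarrow> f = (\<lambda>x. 0)"
  using finite_dom by (auto simp: ip_def supported_def sum_nonneg_eq_0_iff fun_eq_iff)

lemma app_supported: "app f \<in> supported"
  by (simp add: app_def supported_def)

lemma app_add_scale: "app (\<lambda>x. f x + t * g x) = (\<lambda>x. app f x + t * app g x)"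
  by (auto simp: app_def fun_eq_iff algebra_simps sum.distrib sum_distrib_left)

lemma app_scale: "app (\<lambda>x. t * g x) = (\<lambda>x. t * app g x)"
  by (auto simp: app_def fun_eq_iff algebra_simps sum_distrib_left)

lemma app_sym: "ip (app f) g = ip f (app g)"
proof -
  have "ip (app f) g = (\<Sum>x\<in>\<Omega>. \<Sum>y\<in>\<Omega>. K x y * f y * g x)"
    by (simp add: ip_def app_def sum_distrib_right)
  also have "\<dots> = (\<Sum>y\<in>\<Omega>. \<Sum>x\<in>\<Omega>. K x y * f y * g x)"
    by (rule sum.swap)
  also have "\<dots> = ip f (app g)"
    by (auto simp: ip_def app_def sum_distrib_left kernel_sym algebra_simps intro!: sum.cong)
  finally show ?thesis .
qed

section \<open>Orthonormal families and the dimension bound\<close>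

lemma orthonormal_independent:
  assumes "orthonormal B"
  shows "real_fun.independent B"
  unfolding real_fun.independent_explicit_finite_subsets
proof (intro allI impI ballI)
  fix S u v
  assume S: "S \<subseteq> B" "finite S" and 0: "(\<Sum>v\<in>S. fun_scale (u v) v) = 0" and v: "v \<in> S"
  have "(\<lambda>x. \<Sum>w\<in>S. u w * w x) = (\<lambda>x. 0)"
    using 0 by (auto simp: fun_eq_iff sum_fun_apply fun_scale_def)
  then have "0 = ip (\<lambda>x. \<Sum>w\<in>S. u w * w x) v"
    by (simp add: ip_def)
  also have "\<dots> = (\<Sum>w\<in>S. u w * ip w v)"
    by (simp add: ip_sum_left ip_scale_left)
  also have "\<dots> = (\<Sum>w\<in>S. if w = v then u w else 0)"
    using assms S v by (intro sum.cong) (auto simp: orthonormal_def subset_iff)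
  finally show "u v = 0"
    using S v by simp
qed

text \<open>Supplies a spanning family of at most \<open>card \<Omega>\<close> functions, which
  bounds the size of every independent subset of \<open>supported\<close>.\<close>

lemma supported_span_indicators:
  "supported \<subseteq> real_fun.span ((\<lambda>y x. if x = y then 1 else 0) ` \<Omega>)" (is "_ \<subseteq> real_fun.span (?e ` \<Omega>)")
proof
  fix f assume f: "f \<in> supported"
  have "f = (\<Sum>y\<in>\<Omega>. fun_scale (f y) (?e y))"
  proof
    fix x
    have "(\<Sum>y\<in>\<Omega>. f y * (if x = y then 1 else 0)) = (\<Sum>y\<in>\<Omega>. if x = y then f y else 0)"
      by (intro sum.cong) auto
    also have "\<dots> = f x"
      using f finite_dom by (simp add: supported_def)
    finally show "f x = (\<Sum>y\<in>\<Omega>. fun_scale (f y) (?e y)) x"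
      by (simp add: sum_fun_apply fun_scale_def)
  qed
  also have "\<dots> \<in> real_fun.span (?e ` \<Omega>)"
    by (intro real_fun.span_sum real_fun.span_scale real_fun.span_base) auto
  finally show "f \<in> real_fun.span (?e ` \<Omega>)" .
qed

lemma orthonormal_finite:
  assumes "orthonormal B"
  shows "finite B" "card B \<le> card \<Omega>"
proof -
  have "finite B \<and> card B \<le> card ((\<lambda>y x. if x = y then 1 else 0 :: real) ` \<Omega>)"
    using assms orthonormal_independent supported_span_indicators finite_dom
    by (intro real_fun.independent_span_bound) (auto simp: orthonormal_def)
  then show "finite B" "card B \<le> card \<Omega>"
    using card_image_le[OF finite_dom] le_trans by blast+
qed

section \<open>Existence of a complete orthonormal set of eigenfunctions\<close>

definition ortho :: "('a \<Rightarrow> real) set \<Rightarrow> ('a \<Rightarrow> real) set"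
  where "ortho B = {f \<in> supported. \<forall>b\<in>B. ip f b = 0}"

lemma ortho_add_scale:
  "f \<in> ortho B \<Longrightarrow> g \<in> ortho B \<Longrightarrow> (\<lambda>x. f x + t * g x) \<in> ortho B"
  by (auto simp: ortho_def supported_def ip_add_left ip_scale_left)

lemma ortho_scale: "f \<in> ortho B \<Longrightarrow> (\<lambda>x. t * f x) \<in> ortho B"
  by (auto simp: ortho_def supported_def ip_scale_left)

text \<open>Symmetry moves the operator onto \<open>b\<close>, where it only multiplies by the
  eigenvalue.\<close>

lemma app_ortho:
  assumes "f \<in> ortho B" and "\<And>b. b \<in> B \<Longrightarrow> \<exists>\<mu>. b \<in> eigen \<mu>"
  shows "app f \<in> ortho B"
  using assms by (fastforce simp: ortho_def app_supported app_sym eigen_def ip_scale_right)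

text \<open>The function space carries the product topology. There the sphere is closed, and it lies
  in a product of intervals [-1, 1] over \<Omega> and points {0} elsewhere, which is compact by
  Tychonoff.\<close>

lemma compact_unit_sphere: "compact {f \<in> ortho B. ip f f = 1}" (is "compact ?S")
proof -
  define P where "P = (\<Pi>\<^sub>E x\<in>UNIV. if x \<in> \<Omega> then {-1..1::real} else {0})"
  have "compactin (product_topology (\<lambda>x. euclidean) UNIV) P"
    by (auto simp: P_def compactin_PiE)
  then have P: "compact P"
    by (simp add: euclidean_product_topology)
  have cont: "continuous_on UNIV (\<lambda>f. ip f g)" for g
    unfolding ip_def by (intro continuous_intros) auto
  have cont2: "continuous_on UNIV (\<lambda>f. ip f f)"
    unfolding ip_def by (intro continuous_intros) auto
  have coord: "continuous_on UNIV (\<lambda>f. f x :: real)" for x :: 'a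
    by auto
  have "?S = (\<Inter>x\<in>-\<Omega>. {f. f x = 0}) \<inter> (\<Inter>b\<in>B. {f. ip f b = 0}) \<inter> {f. ip f f = 1}"
    by (auto simp: ortho_def supported_def)
  moreover have "closed \<dots>"
    by (intro closed_Int closed_INT ballI closed_Collect_eq cont cont2 coord continuous_on_const)
  ultimately have "closed ?S"
    by simp
  moreover have "?S \<subseteq> P"
  proof
    fix f assume f: "f \<in> ?S"
    have "\<bar>f x\<bar> \<le> 1" if "x \<in> \<Omega>" for x
    proof -
      have "f x * f x \<le> ip f f"
        unfolding ip_def using that finite_dom by (intro member_le_sum) auto
      then show ?thesis
        using f by (simp flip: abs_square_le_1 add: power2_eq_square)
    qed
    then show "f \<in> P"
      using f by (fastforce simp: P_def ortho_def supported_def PiE_def abs_le_iff)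
  qed
  ultimately show ?thesis
    using P compact_Int_closed[of P ?S] by (simp add: Int_absorb1)
qed

text \<open>A maximiser of the Rayleigh quotient is an eigenvector: comparing it with its perturbation
  in the direction of the residual forces the residual to vanish.\<close>

lemma eigenvector_in_ortho:
  assumes B: "\<forall>b\<in>B. \<exists>\<mu>. b \<in> eigen \<mu>"
    and h: "h \<in> ortho B" "h \<noteq> (\<lambda>x. 0)"
  shows "\<exists>f\<in>ortho B. ip f f = 1 \<and> (\<exists>\<mu>. f \<in> eigen \<mu>)"
proof -
  let ?S = "{f \<in> ortho B. ip f f = 1}"
  have norm: "\<exists>s. ip (\<lambda>x. s * g x) (\<lambda>x. s * g x) = 1 \<and> s\<^sup>2 * ip g g = 1"
    if "g \<in> ortho B" "g \<noteq> (\<lambda>x. 0)" for g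
  proof -
    have "ip g g \<noteq> 0"
      using that ip_self_eq_0 by (auto simp: ortho_def)
    then have "ip g g > 0"
      using ip_self_nonneg[of g] by simp
    then show ?thesis
      unfolding ip_scale_left ip_scale_right
      by (intro exI[of _ "1 / sqrt (ip g g)"]) (simp add: power2_eq_square)
  qed
  have "?S \<noteq> {}"
    using norm[OF h] ortho_scale[OF h(1)] by blast
  moreover have "continuous_on ?S (\<lambda>f. ip (app f) f)"
  proof -
    have "ip (app f) f = (\<Sum>x\<in>\<Omega>. (\<Sum>y\<in>\<Omega>. K x y * f y) * f x)" for f
      by (simp add: ip_def app_def)
    moreover have "continuous_on UNIV (\<lambda>f. \<Sum>x\<in>\<Omega>. (\<Sum>y\<in>\<Omega>. K x y * f y) * f x)"
      by (intro continuous_intros) auto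
    ultimately show ?thesis
      using continuous_on_subset by fastforce
  qed
  ultimately obtain f where f: "f \<in> ?S" and max: "\<And>g. g \<in> ?S \<Longrightarrow> ip (app g) g \<le> ip (app f) f"
    using continuous_attains_sup[OF compact_unit_sphere] by blast
  define M where "M = ip (app f) f"
  \<comment> \<open>Both sides are homogeneous of degree 2, so maximality on the sphere extends to
    the whole complement.\<close>
  have le: "ip (app g) g \<le> M * ip g g" if g: "g \<in> ortho B" for g
  proof (cases "g = (\<lambda>x. 0)")
    case True
    then show ?thesis
      by (simp add: ip_def)
  next
    case False
    then obtain s where s: "ip (\<lambda>x. s * g x) (\<lambda>x. s * g x) = 1" "s\<^sup>2 * ip g g = 1"
      using norm g by blast
    then have "s\<^sup>2 * ip (app g) g \<le> M * (s\<^sup>2 * ip g g)"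
      using max[of "\<lambda>x. s * g x"] ortho_scale[OF g]
      by (simp add: M_def app_scale ip_scale_left ip_scale_right power2_eq_square mult.assoc)
    moreover have "s\<^sup>2 > 0"
      using s by (cases "s = 0") auto
    ultimately show ?thesis
      by (simp add: mult.left_commute)
  qed
  define r where "r = (\<lambda>x. app f x + (- M) * f x)"
  have r: "r \<in> ortho B"
    unfolding r_def using f B by (intro ortho_add_scale app_ortho) auto
  define s where "s = ip r r"
  define c where "c = M * ip r r - ip (app r) r"
  have c: "c \<ge> 0"
    using le[OF r] by (simp add: c_def)
  have s_eq: "s = ip (app f) r - M * ip f r"
    by (simp add: s_def r_def ip_diff_left ip_scale_left)
  \<comment> \<open>This is \<open>le\<close> at \<open>f + t r\<close>: the constant terms
    \<open>M\<close> cancel, the linear coefficient is \<open>2 s\<close>, and the quadratic terms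
    collect into \<open>c\<close>.\<close>
  have bound: "2 * t * s \<le> t\<^sup>2 * c" for t
  proof -
    have "ip (app (\<lambda>x. f x + t * r x)) (\<lambda>x. f x + t * r x)
        = M + 2 * t * ip (app f) r + t\<^sup>2 * ip (app r) r"
      using app_sym[of r f] ip_commute[of r "app f"]
      by (simp add: app_add_scale ip_add_left ip_add_right ip_scale_left ip_scale_right M_def
          algebra_simps power2_eq_square)
    moreover have "ip (\<lambda>x. f x + t * r x) (\<lambda>x. f x + t * r x) = 1 + 2 * t * ip f r + t\<^sup>2 * ip r r"
      using f ip_commute[of r f]
      by (simp add: ip_add_left ip_add_right ip_scale_left ip_scale_right
          algebra_simps power2_eq_square)
    ultimately have "M + 2 * t * ip (app f) r + t\<^sup>2 * ip (app r) r
        \<le> M * (1 + 2 * t * ip f r + t\<^sup>2 * ip r r)"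
      using le[of "\<lambda>x. f x + t * r x"] f r ortho_add_scale by auto
    then show ?thesis
      by (simp add: s_eq c_def algebra_simps)
  qed
  have "s = 0"
  proof -
    \<comment> \<open>The choice \<open>t = s / (c + 1)\<close>, with denominators cleared, gives
      \<open>2 s\<^sup>2 (c + 1) \<le> s\<^sup>2 c\<close>; the summand 1 keeps the denominator
      positive when \<open>c = 0\<close>.\<close>
    have le: "2 * (s / (c + 1)) * s * (c + 1)\<^sup>2 \<le> (s / (c + 1))\<^sup>2 * c * (c + 1)\<^sup>2"
      by (rule mult_right_mono[OF bound]) simp
    have eq1: "2 * (s / (c + 1)) * s * (c + 1)\<^sup>2 = 2 * s\<^sup>2 * (c + 1)"
      using c by (simp add: power2_eq_square)
    have eq2: "(s / (c + 1))\<^sup>2 * c * (c + 1)\<^sup>2 = s\<^sup>2 * c"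
      using c by (simp add: power_divide)
    have "s\<^sup>2 * c + 2 * s\<^sup>2 \<le> 0"
      using le unfolding eq1 eq2 by (simp add: algebra_simps)
    moreover have "s\<^sup>2 * c \<ge> 0"
      using c by simp
    ultimately have "s\<^sup>2 \<le> 0"
      by linarith
    then show ?thesis
      by simp
  qed
  then have "r = (\<lambda>x. 0)"
    using ip_self_eq_0 r by (auto simp: s_def ortho_def)
  then have "app f = (\<lambda>x. M * f x)"
    by (auto simp: r_def fun_eq_iff)
  then have "f \<in> eigen M"
    using f by (auto simp: eigen_def ortho_def)
  then show ?thesis
    using f by blast
qed

text \<open>Take an orthonormal set of eigenvectors of greatest cardinality. A nonzero function in
  its complement would yield a further unit eigenvector there, and hence a larger set.\<close>

lemma eigenbasis_exists:
  obtains B where "orthonormal B" "\<And>b. b \<in> B \<Longrightarrow> \<exists>\<mu>. b \<in> eigen \<mu>" "ortho B \<subseteq> {\<lambda>x. 0}"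
proof -
  define P where "P B \<longleftrightarrow> orthonormal B \<and> (\<forall>b\<in>B. \<exists>\<mu>. b \<in> eigen \<mu>)" for B
  have "P {}"
    by (simp add: P_def orthonormal_def)
  moreover have "\<forall>B. P B \<longrightarrow> card B < Suc (card \<Omega>)"
    using orthonormal_finite by (auto simp: P_def less_Suc_eq_le)
  ultimately have "\<exists>B. P B \<and> (\<forall>C. P C \<longrightarrow> card C \<le> card B)"
    by (rule ex_has_greatest_nat)
  then obtain B where B: "P B" and max: "\<And>C. P C \<Longrightarrow> card C \<le> card B"
    by auto
  have "ortho B \<subseteq> {\<lambda>x. 0}"
  proof (rule ccontr)
    assume "\<not> ortho B \<subseteq> {\<lambda>x. 0}"
    then obtain h where h: "h \<in> ortho B" "h \<noteq> (\<lambda>x. 0)"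
      by blast
    have "\<forall>b\<in>B. \<exists>\<mu>. b \<in> eigen \<mu>"
      using B by (simp add: P_def)
    from eigenvector_in_ortho[OF this h]
    obtain f \<mu> where f: "f \<in> ortho B" "ip f f = 1" "f \<in> eigen \<mu>"
      by blast
    have "f \<notin> B"
      using f by (auto simp: ortho_def)
    moreover have "ip f b = 0" "ip b f = 0" if "b \<in> B" for b
      using f(1) that ip_commute[of b f] by (auto simp: ortho_def)
    ultimately have "P (insert f B)"
      using B f by (auto simp: P_def orthonormal_def ortho_def)
    then show False
      using max[of "insert f B"] B \<open>f \<notin> B\<close> orthonormal_finite(1) by (simp add: P_def)
  qed
  then show ?thesis
    using that B by (auto simp: P_def)
qed

section \<open>Expansions, multiplicities and the ordered spectrum\<close>

definition eigenbasis :: "('a \<Rightarrow> real) set \<Rightarrow> (('a \<Rightarrow> real) \<Rightarrow> real) \<Rightarrow> bool"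
  where "eigenbasis B ev \<longleftrightarrow> orthonormal B \<and> ortho B \<subseteq> {\<lambda>x. 0} \<and> (\<forall>b\<in>B. b \<in> eigen (ev b))"

text \<open>The residual is orthogonal to all of \<open>B\<close>, so it lies in the trivial
  complement.\<close>

lemma expansion:
  assumes "orthonormal B" "ortho B \<subseteq> {\<lambda>x. 0}" "f \<in> supported"
  shows "f = (\<lambda>x. \<Sum>b\<in>B. ip f b * b x)"
proof -
  define r where "r = (\<lambda>x. f x - (\<Sum>b\<in>B. ip f b * b x))"
  have "ip r c = 0" if c: "c \<in> B" for c
  proof -
    have "(\<Sum>b\<in>B. ip f b * ip b c) = (\<Sum>b\<in>B. if b = c then ip f b else 0)"
      using assms(1) c by (intro sum.cong) (auto simp: orthonormal_def)
    also have "\<dots> = ip f c"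
      using c orthonormal_finite(1)[OF assms(1)] by simp
    finally show ?thesis
      by (simp add: r_def ip_diff_left ip_sum_left ip_scale_left)
  qed
  moreover have "r \<in> supported"
    using assms(1,3) by (auto simp: r_def supported_def orthonormal_def subset_iff intro!: sum.neutral)
  ultimately have "r = (\<lambda>x. 0)"
    using assms(2) by (auto simp: ortho_def)
  then show ?thesis
    by (auto simp: r_def fun_eq_iff)
qed

lemma parseval:
  assumes "orthonormal B" "ortho B \<subseteq> {\<lambda>x. 0}" "f \<in> supported"
  shows "ip f g = (\<Sum>b\<in>B. ip f b * ip g b)"
proof -
  have "ip f g = ip (\<lambda>x. \<Sum>b\<in>B. ip f b * b x) g"
    using expansion[OF assms] by simp
  also have "\<dots> = (\<Sum>b\<in>B. ip f b * ip g b)"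
    by (simp add: ip_sum_left ip_scale_left ip_commute[of _ g])
  finally show ?thesis .
qed

text \<open>Serves twice: with \<open>C\<close> equal to \<open>B\<close> to count the basis, and
  with \<open>C\<close> the basis vectors of one eigenvalue to find the dimension of its
  eigenspace.\<close>

lemma expansion_in_span:
  assumes "orthonormal B" "ortho B \<subseteq> {\<lambda>x. 0}" "f \<in> supported"
    and "\<And>b. b \<in> B \<Longrightarrow> b \<notin> C \<Longrightarrow> ip f b = 0"
  shows "f \<in> real_fun.span C"
proof -
  have "f = (\<Sum>b\<in>B. fun_scale (ip f b) b)"
    using expansion[OF assms(1-3)] by (auto simp: fun_eq_iff sum_fun_apply fun_scale_def)
  also have "\<dots> \<in> real_fun.span C"
  proof (rule real_fun.span_sum)
    fix b assume "b \<in> B"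
    show "fun_scale (ip f b) b \<in> real_fun.span C"
    proof (cases "b \<in> C")
      case True
      then show ?thesis
        by (intro real_fun.span_scale real_fun.span_base)
    next
      case False
      have "fun_scale 0 b \<in> real_fun.span C"
        using real_fun.span_zero by simp
      then show ?thesis
        using assms(4)[OF \<open>b \<in> B\<close> False] by simp
    qed
  qed
  finally show ?thesis .
qed

text \<open>The point indicators form another orthonormal set, of size \<open>card \<Omega>\<close>,
  inside the span of \<open>B\<close>; their independence gives the inequality missing from
  \<open>orthonormal_finite\<close>.\<close>

lemma card_eigenbasis:
  assumes "orthonormal B" "ortho B \<subseteq> {\<lambda>x. 0}"
  shows "card B = card \<Omega>"
proof -
  let ?e = "\<lambda>y x. if x = y then 1 else 0 :: real"
  have inj: "inj_on ?e \<Omega>"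
    by (rule inj_onI) (metis zero_neq_one)
  have e: "orthonormal (?e ` \<Omega>)"
  proof -
    have "ip (?e y) (?e z) = (if y = z then 1 else 0)" if "y \<in> \<Omega>" "z \<in> \<Omega>" for y z
    proof -
      have "ip (?e y) (?e z) = (\<Sum>x\<in>\<Omega>. if x = y then ?e z x else 0)"
        unfolding ip_def by (intro sum.cong) auto
      then show ?thesis
        using that finite_dom by simp
    qed
    then show ?thesis
      using inj unfolding orthonormal_def supported_def by (auto dest: inj_onD)
  qed
  have "?e ` \<Omega> \<subseteq> supported"
    using e by (simp add: orthonormal_def)
  then have "?e ` \<Omega> \<subseteq> real_fun.span B"
    using expansion_in_span[OF assms] by blast
  then have "card (?e ` \<Omega>) \<le> card B"
    using real_fun.independent_span_bound[OF orthonormal_finite(1)[OF assms(1)]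
        orthonormal_independent[OF e]] by simp
  then show ?thesis
    using orthonormal_finite(2)[OF assms(1)] card_image[OF inj] by simp
qed

lemma ip_eigen_distinct:
  assumes "f \<in> eigen \<mu>" "g \<in> eigen \<nu>" "\<mu> \<noteq> \<nu>"
  shows "ip f g = 0"
proof -
  have "\<mu> * ip f g = \<nu> * ip f g"
    using app_sym[of f g] assms by (simp add: eigen_def ip_scale_left ip_scale_right)
  then show ?thesis
    using assms(3) by simp
qed

text \<open>An eigenvector for \<mu> is orthogonal to the basis vectors with other eigenvalues, so
  its expansion uses only those with eigenvalue \<mu>.\<close>

lemma dim_eigen:
  assumes "eigenbasis B ev"
  shows "real_fun.dim (eigen \<mu>) = card {b \<in> B. ev b = \<mu>}"
proof (rule real_fun.dim_unique[OF _ _ _ refl])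
  show "{b \<in> B. ev b = \<mu>} \<subseteq> eigen \<mu>"
    using assms by (auto simp: eigenbasis_def)
  show "eigen \<mu> \<subseteq> real_fun.span {b \<in> B. ev b = \<mu>}"
  proof
    fix f assume f: "f \<in> eigen \<mu>"
    show "f \<in> real_fun.span {b \<in> B. ev b = \<mu>}"
    proof (rule expansion_in_span)
      show "orthonormal B" "ortho B \<subseteq> {\<lambda>x. 0}" "f \<in> supported"
        using assms f by (auto simp: eigenbasis_def eigen_def)
      show "ip f b = 0" if "b \<in> B" "b \<notin> {b \<in> B. ev b = \<mu>}" for b
        using that assms f ip_eigen_distinct by (auto simp: eigenbasis_def)
    qed
  qed
  show "real_fun.independent {b \<in> B. ev b = \<mu>}"
    using assms by (intro orthonormal_independent) (auto simp: eigenbasis_def orthonormal_def)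
qed

lemma spectrum_eigenbasis:
  assumes "eigenbasis B ev"
  shows "{\<mu>. \<exists>f\<in>eigen \<mu>. f \<noteq> (\<lambda>x. 0)} = ev ` B"
proof (intro equalityI subsetI)
  fix \<mu> assume "\<mu> \<in> {\<mu>. \<exists>f\<in>eigen \<mu>. f \<noteq> (\<lambda>x. 0)}"
  then obtain f where f: "f \<in> eigen \<mu>" "f \<noteq> (\<lambda>x. 0)"
    by blast
  show "\<mu> \<in> ev ` B"
  proof (rule ccontr)
    assume "\<mu> \<notin> ev ` B"
    then have "f \<in> ortho B"
      using f assms ip_eigen_distinct by (fastforce simp: ortho_def eigenbasis_def eigen_def)
    then show False
      using f assms by (auto simp: eigenbasis_def)
  qed
next
  fix \<mu> assume "\<mu> \<in> ev ` B"
  then obtain b where b: "b \<in> B" "\<mu> = ev b"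
    by blast
  have "ip b b = 1"
    using b assms by (auto simp: eigenbasis_def orthonormal_def)
  then have "b \<noteq> (\<lambda>x. 0)"
    by (auto simp: ip_def)
  then show "\<mu> \<in> {\<mu>. \<exists>f\<in>eigen \<mu>. f \<noteq> (\<lambda>x. 0)}"
    using b assms by (auto simp: eigenbasis_def)
qed

text \<open>Links the list built from eigenspace dimensions to an eigenbasis indexed by position. In
  both lists a value occurs as often as it is the eigenvalue of a basis vector, and a sorted list is
  determined by its multiset.\<close>

lemma eigenvalue_list:
  obtains bs ev where "eigenbasis (set bs) ev" "distinct bs" "length bs = card \<Omega>" "sorted (map ev bs)"
    "concat (map (\<lambda>\<mu>. replicate (real_fun.dim (eigen \<mu>)) \<mu>)
      (sorted_list_of_set {\<mu>. \<exists>f\<in>eigen \<mu>. f \<noteq> (\<lambda>x. 0)})) = map ev bs"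
proof -
  obtain B where B: "orthonormal B" "\<And>b. b \<in> B \<Longrightarrow> \<exists>\<mu>. b \<in> eigen \<mu>" "ortho B \<subseteq> {\<lambda>x. 0}"
    using eigenbasis_exists by blast
  obtain ev where "\<And>b. b \<in> B \<Longrightarrow> b \<in> eigen (ev b)"
    using B(2) by metis
  then have eb: "eigenbasis B ev"
    using B by (simp add: eigenbasis_def)
  have fin: "finite B"
    using orthonormal_finite B by blast
  then obtain cs where cs: "set cs = B" "distinct cs"
    using finite_distinct_list by blast
  define bs where "bs = sort_key ev cs"
  have bs: "set bs = B" "distinct bs" "mset bs = mset_set B"
    using cs by (auto simp: bs_def mset_set_set)
  let ?l = "concat (map (\<lambda>\<mu>. replicate (real_fun.dim (eigen \<mu>)) \<mu>)
      (sorted_list_of_set {\<mu>. \<exists>f\<in>eigen \<mu>. f \<noteq> (\<lambda>x. 0)}))"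
  have "mset (map ev bs) = mset ?l"
  proof (rule multiset_eqI)
    fix y
    have "count (mset (map ev bs)) y = card {b \<in> B. ev b = y}"
      using bs fin by (auto simp: count_image_mset' simp flip: card_eq_sum intro!: arg_cong[where f = card])
    moreover have "count (mset ?l) y = card {b \<in> B. ev b = y}"
      using fin by (auto simp: count_concat_replicate spectrum_eigenbasis[OF eb] dim_eigen[OF eb])
    ultimately show "count (mset (map ev bs)) y = count (mset ?l) y"
      by simp
  qed
  then have sort1: "sort ?l = map ev bs"
    by (rule properties_for_sort) (simp add: bs_def)
  have sort2: "sort ?l = ?l"
    by (intro properties_for_sort sorted_concat_replicate refl sorted_sorted_list_of_set)
  have l_eq: "?l = map ev bs"
    by (rule trans[OF sort2[symmetric] sort1])
  have len: "length bs = card \<Omega>"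
    using card_eigenbasis[OF B(1,3)] bs distinct_card by fastforce
  show ?thesis
    by (rule that[OF _ bs(2) len _ l_eq]) (use eb bs(1) in \<open>simp_all add: bs_def\<close>)
qed

section \<open>The commutator inequality\<close>

text \<open>The commutator [H, g] applied to \<open>f\<close>, where H is \<open>app\<close> and
  \<open>g\<close> acts by multiplication; its kernel is \<open>K x y * (g y - g x)\<close>.\<close>

definition commutator_apply :: "('a \<Rightarrow> real) \<Rightarrow> ('a \<Rightarrow> real) \<Rightarrow> 'a \<Rightarrow> real"
  where "commutator_apply g f = (\<lambda>x. if x \<in> \<Omega> then \<Sum>y\<in>\<Omega>. K x y * (g y - g x) * f y else 0)"

text \<open>In the commutator \<open>app (g b) - g (app b)\<close>, symmetry lets the first term act
  on \<open>c\<close> and produce \<gamma>, while the second produces \<beta>.\<close>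

lemma ip_commutator_apply:
  assumes "b \<in> eigen \<beta>" "c \<in> eigen \<gamma>"
  shows "ip (commutator_apply g b) c = (\<gamma> - \<beta>) * ip (\<lambda>x. g x * b x) c"
proof -
  have "commutator_apply g b = (\<lambda>x. app (\<lambda>y. g y * b y) x - g x * app b x)"
    by (auto simp: commutator_apply_def app_def fun_eq_iff algebra_simps sum_subtractf
        sum_distrib_left)
  then have "ip (commutator_apply g b) c
      = ip (app (\<lambda>y. g y * b y)) c - ip (\<lambda>x. g x * app b x) c"
    by (simp add: ip_diff_left)
  also have "(\<lambda>x. g x * app b x) = (\<lambda>x. \<beta> * (g x * b x))"
    using assms(1) by (auto simp: eigen_def)
  also have "ip (app (\<lambda>y. g y * b y)) c = \<gamma> * ip (\<lambda>x. g x * b x) c"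
    using assms(2) by (simp add: app_sym eigen_def ip_scale_right)
  finally show ?thesis
    by (simp add: ip_scale_left algebra_simps)
qed

text \<open>The left-hand side is the quadratic form of [g, [H, g]]. Adding to the right-hand
  summand its copy with \<open>x\<close> and \<open>y\<close> exchanged yields \<open>(g y - g x) *
  g x + (g x - g y) * g y = - (g x - g y)\<^sup>2\<close>.\<close>

lemma double_commutator_form:
  "(\<Sum>x\<in>\<Omega>. \<Sum>y\<in>\<Omega>. - K x y * (g x - g y)\<^sup>2 * f x * f y)
    = 2 * ip (commutator_apply g f) (\<lambda>x. g x * f x)"
proof -
  let ?F = "\<lambda>x y. K x y * (g y - g x) * f y * (g x * f x)"
  have "ip (commutator_apply g f) (\<lambda>x. g x * f x) = (\<Sum>x\<in>\<Omega>. \<Sum>y\<in>\<Omega>. ?F x y)"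
    by (simp add: ip_def commutator_apply_def sum_distrib_right)
  moreover have "(\<Sum>x\<in>\<Omega>. \<Sum>y\<in>\<Omega>. ?F x y) = (\<Sum>x\<in>\<Omega>. \<Sum>y\<in>\<Omega>. ?F y x)"
    by (rule sum.swap)
  moreover have "(\<Sum>x\<in>\<Omega>. \<Sum>y\<in>\<Omega>. - K x y * (g x - g y)\<^sup>2 * f x * f y)
    = (\<Sum>x\<in>\<Omega>. \<Sum>y\<in>\<Omega>. ?F x y + ?F y x)"
  proof (intro sum.cong refl)
    fix x y assume "x \<in> \<Omega>" "y \<in> \<Omega>"
    then have K: "K y x = K x y"
      by (rule kernel_sym[symmetric])
    show "- K x y * (g x - g y)\<^sup>2 * f x * f y = ?F x y + ?F y x"
      unfolding K by (simp add: algebra_simps power2_eq_square)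
  qed
  ultimately show ?thesis
    by (simp add: sum.distrib)
qed

text \<open>The terms with both indices in \<open>S\<close> cancel by antisymmetry; for the remaining ones
  \<open>ev c - ev b \<le> (ev c - ev b)\<^sup>2 / (\<Lambda> - ev b)\<close>.\<close>

lemma commutator_inequality:
  assumes eb: "eigenbasis B ev" and S: "S \<subseteq> B"
    and low: "\<And>b. b \<in> S \<Longrightarrow> ev b < \<Lambda>" and high: "\<And>c. c \<in> B - S \<Longrightarrow> \<Lambda> \<le> ev c"
  shows "(\<Sum>b\<in>S. \<Sum>x\<in>\<Omega>. \<Sum>y\<in>\<Omega>. - K x y * (g x - g y)\<^sup>2 * b x * b y)
    \<le> 2 * (\<Sum>b\<in>S. (\<Sum>x\<in>\<Omega>. (\<Sum>y\<in>\<Omega>. K x y * (g y - g x) * b y)\<^sup>2) / (\<Lambda> - ev b))"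
proof -
  define G where "G b c = ip (\<lambda>x. g x * b x) c" for b c
  have on: "orthonormal B" "ortho B \<subseteq> {\<lambda>x. 0}" and ev: "\<And>b. b \<in> B \<Longrightarrow> b \<in> eigen (ev b)"
    using eb by (auto simp: eigenbasis_def)
  have fin: "finite B" "finite S"
    using orthonormal_finite(1)[OF on(1)] S finite_subset by auto
  have G_sym: "G b c = G c b" for b c
    by (simp add: G_def ip_def algebra_simps)
  have supp: "commutator_apply g b \<in> supported" for b
    by (simp add: commutator_apply_def supported_def)
  have comm: "ip (commutator_apply g b) c = (ev c - ev b) * G b c" if "b \<in> B" "c \<in> B" for b c
    unfolding G_def by (rule ip_commutator_apply[OF ev ev]) fact+
  \<comment> \<open>Parseval for the commutator and \<open>g b\<close>: their coefficients at
    \<open>c\<close> are \<open>(ev c - ev b) * G b c\<close> and \<open>G b c\<close>.\<close>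
  have form: "(\<Sum>x\<in>\<Omega>. \<Sum>y\<in>\<Omega>. - K x y * (g x - g y)\<^sup>2 * b x * b y)
      = 2 * (\<Sum>c\<in>B. (ev c - ev b) * (G b c)\<^sup>2)" if "b \<in> B" for b
    unfolding double_commutator_form
    by (subst parseval[OF on supp]) (use that in \<open>auto simp: comm power2_eq_square ip_commute[of _ "\<lambda>x. g x * b x"] simp flip: G_def intro!: sum.cong\<close>)
  have norm: "(\<Sum>x\<in>\<Omega>. (\<Sum>y\<in>\<Omega>. K x y * (g y - g x) * b y)\<^sup>2)
      = (\<Sum>c\<in>B. (ev c - ev b)\<^sup>2 * (G b c)\<^sup>2)" if "b \<in> B" for b
  proof -
    have "(\<Sum>x\<in>\<Omega>. (\<Sum>y\<in>\<Omega>. K x y * (g y - g x) * b y)\<^sup>2)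
        = ip (commutator_apply g b) (commutator_apply g b)"
      by (simp add: ip_def commutator_apply_def power2_eq_square)
    also have "\<dots> = (\<Sum>c\<in>B. (ev c - ev b)\<^sup>2 * (G b c)\<^sup>2)"
      by (subst parseval[OF on supp])
        (use that in \<open>auto simp: comm power2_eq_square intro!: sum.cong\<close>)
    finally show ?thesis .
  qed
  have split: "(\<Sum>c\<in>B. h c) = (\<Sum>c\<in>S. h c) + (\<Sum>c\<in>B - S. h c)" for h :: "_ \<Rightarrow> real"
    using sum.subset_diff[OF S fin(1)] by (simp add: add.commute)
  have cancel: "(\<Sum>b\<in>S. \<Sum>c\<in>S. (ev c - ev b) * (G b c)\<^sup>2) = 0"
  proof -
    have "(\<Sum>b\<in>S. \<Sum>c\<in>S. (ev c - ev b) * (G b c)\<^sup>2)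
        = (\<Sum>b\<in>S. \<Sum>c\<in>S. (ev b - ev c) * (G c b)\<^sup>2)"
      by (rule sum.swap)
    also have "\<dots> = - (\<Sum>b\<in>S. \<Sum>c\<in>S. (ev c - ev b) * (G b c)\<^sup>2)"
      unfolding sum_negf[symmetric] using G_sym by (intro sum.cong refl) (simp add: algebra_simps)
    finally show ?thesis
      by simp
  qed
  have "(\<Sum>b\<in>S. \<Sum>x\<in>\<Omega>. \<Sum>y\<in>\<Omega>. - K x y * (g x - g y)\<^sup>2 * b x * b y)
      = 2 * (\<Sum>b\<in>S. \<Sum>c\<in>B. (ev c - ev b) * (G b c)\<^sup>2)"
    unfolding sum_distrib_left[of 2 _ S] using S form by (intro sum.cong refl) blast
  also have "\<dots> = 2 * (\<Sum>b\<in>S. \<Sum>c\<in>B - S. (ev c - ev b) * (G b c)\<^sup>2)"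
    unfolding split sum.distrib cancel by simp
  also have "\<dots> \<le> 2 * (\<Sum>b\<in>S. (\<Sum>c\<in>B. (ev c - ev b)\<^sup>2 * (G b c)\<^sup>2) / (\<Lambda> - ev b))"
  proof (intro mult_left_mono sum_mono)
    fix b assume b: "b \<in> S"
    have pos: "\<Lambda> - ev b > 0"
      using low[OF b] by simp
    have "(\<Sum>c\<in>B - S. (ev c - ev b) * (G b c)\<^sup>2) * (\<Lambda> - ev b)
        = (\<Sum>c\<in>B - S. (ev c - ev b) * (\<Lambda> - ev b) * (G b c)\<^sup>2)"
      unfolding sum_distrib_right by (intro sum.cong refl) (simp add: mult_ac)
    also have "\<dots> \<le> (\<Sum>c\<in>B - S. (ev c - ev b)\<^sup>2 * (G b c)\<^sup>2)"
    proof (intro sum_mono mult_right_mono)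
      fix c assume "c \<in> B - S"
      then have "\<Lambda> \<le> ev c"
        by (rule high)
      then show "(ev c - ev b) * (\<Lambda> - ev b) \<le> (ev c - ev b)\<^sup>2"
        unfolding power2_eq_square using pos by (intro mult_left_mono) auto
    qed simp
    \<comment> \<open>Adding the nonnegative terms with \<open>c\<close> in \<open>S\<close>
      completes the sum to the squared norm of the commutator.\<close>
    also have "\<dots> \<le> (\<Sum>c\<in>B. (ev c - ev b)\<^sup>2 * (G b c)\<^sup>2)"
      using fin by (intro sum_mono2) auto
    finally show "(\<Sum>c\<in>B - S. (ev c - ev b) * (G b c)\<^sup>2)
        \<le> (\<Sum>c\<in>B. (ev c - ev b)\<^sup>2 * (G b c)\<^sup>2) / (\<Lambda> - ev b)"
      using pos by (simp add: pos_le_divide_eq)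
  qed simp
  also have "\<dots> = 2 * (\<Sum>b\<in>S. (\<Sum>x\<in>\<Omega>. (\<Sum>y\<in>\<Omega>. K x y * (g y - g x) * b y)\<^sup>2) / (\<Lambda> - ev b))"
    using S by (simp add: subset_iff norm cong: sum.cong)
  finally show ?thesis .
qed

end

section \<open>The lattice\<close>

lemma adjacent_iff:
  "adjacent x y \<longleftrightarrow> (\<exists>i. \<exists>s\<in>{1, -1}. y = x + axis i s)" for x y :: "int ^ 'n"
proof
  assume adj: "adjacent x y"
  have "\<exists>i. x $ i \<noteq> y $ i"
    by (rule ccontr) (use adj in \<open>simp add: adjacent_def\<close>)
  then obtain i where i: "x $ i \<noteq> y $ i"
    by blast
  have split: "\<bar>x $ i - y $ i\<bar> + (\<Sum>j\<in>UNIV - {i}. \<bar>x $ j - y $ j\<bar>) = 1"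
    using adj sum.remove[of UNIV i "\<lambda>j. \<bar>x $ j - y $ j\<bar>"] by (simp add: adjacent_def)
  have nonneg: "(\<Sum>j\<in>UNIV - {i}. \<bar>x $ j - y $ j\<bar>) \<ge> 0"
    by (intro sum_nonneg) simp
  \<comment> \<open>A nonzero integer has absolute value at least 1, so coordinate \<open>i\<close>
    uses up the whole distance.\<close>
  have one: "\<bar>x $ i - y $ i\<bar> = 1"
    using i split nonneg by arith
  then have "(\<Sum>j\<in>UNIV - {i}. \<bar>x $ j - y $ j\<bar>) = 0"
    using split by simp
  then have "\<forall>j\<in>UNIV - {i}. \<bar>x $ j - y $ j\<bar> = 0"
    by (subst (asm) sum_nonneg_eq_0_iff) auto
  then have "y = x + axis i (y $ i - x $ i)"
    by (auto simp: vec_eq_iff axis_def)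
  moreover have "y $ i - x $ i \<in> {1, -1}"
    using one by auto
  ultimately show "\<exists>i. \<exists>s\<in>{1, -1}. y = x + axis i s"
    by blast
next
  assume "\<exists>i. \<exists>s\<in>{1, -1}. y = x + axis i s"
  then obtain i s where s: "s \<in> {1, -1}" and y: "y = x + axis i s"
    by blast
  have "(\<Sum>j\<in>UNIV. \<bar>x $ j - y $ j\<bar>) = (\<Sum>j\<in>UNIV. if j = i then \<bar>s\<bar> else 0)"
    unfolding y by (intro sum.cong) (auto simp: axis_def)
  also have "\<dots> = 1"
    using s by auto
  finally show "adjacent x y"
    by (simp add: adjacent_def)
qed

lemma adjacent_commute: "adjacent x y \<longleftrightarrow> adjacent y x"
  by (simp add: adjacent_def abs_minus_commute)

lemma not_adjacent_self: "\<not> adjacent x x"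
  by (simp add: adjacent_def)

text \<open>Neighbours differ by a signed unit vector. Through this fact, summing over all
  coordinate functions replaces the weights \<open>(g x - g y)\<^sup>2\<close> by 1 on every
  edge.\<close>

lemma adjacent_sum_squares:
  assumes "adjacent x y"
  shows "(\<Sum>i\<in>UNIV. (real_of_int (x $ i) - real_of_int (y $ i))\<^sup>2) = 1"
proof -
  obtain i s where s: "s \<in> {1, -1}" and y: "y = x + axis i s"
    using assms adjacent_iff by blast
  have "(\<Sum>j\<in>UNIV. (real_of_int (x $ j) - real_of_int (y $ j))\<^sup>2)
      = (\<Sum>j\<in>UNIV. if j = i then (real_of_int s)\<^sup>2 else 0)"
    unfolding y by (intro sum.cong) (auto simp: axis_def)
  also have "\<dots> = 1"
    using s by auto
  finally show ?thesis .
qed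

lemma adjacent_image:
  "{y. adjacent x y} = (\<lambda>(i, s). x + axis i s) ` (UNIV \<times> {1, -1})"
  by (auto simp: adjacent_iff)

lemma finite_adjacent: "finite {y. adjacent x y}"
  by (simp add: adjacent_image)

lemma axis_minus: "axis i (- a) = - axis i a" for a :: int
  by (simp add: vec_eq_iff axis_def)

text \<open>Grouping the neighbours in opposite pairs, one per direction, matches the central
  differences used later.\<close>

definition neighbour_sum :: "(int ^ 'n \<Rightarrow> real) \<Rightarrow> int ^ 'n \<Rightarrow> real"
  where "neighbour_sum f x = (\<Sum>i\<in>UNIV. f (x + axis i 1) + f (x - axis i 1))"

lemma sum_adjacent: "(\<Sum>y | adjacent x y. f y) = neighbour_sum f x"
proof -
  have "inj_on (\<lambda>(i, s). x + axis i s) (UNIV \<times> {1, -1})"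
    by (auto simp: inj_on_def axis_eq_axis)
  then have "(\<Sum>y | adjacent x y. f y) = (\<Sum>(i, s)\<in>UNIV \<times> {1, -1}. f (x + axis i s))"
    unfolding adjacent_image by (simp add: sum.reindex case_prod_unfold)
  also have "\<dots> = (\<Sum>i\<in>UNIV. \<Sum>s\<in>{1, -1}. f (x + axis i s))"
    by (simp only: sum.cartesian_product)
  finally show ?thesis
    by (simp add: neighbour_sum_def axis_minus)
qed

lemma vertex_degree_eq: "real (vertex_degree x) = 2 * real CARD('n)" for x :: "int ^ 'n"
  using sum_adjacent[where x = x and f = "\<lambda>_. 1"] by (simp add: vertex_degree_def neighbour_sum_def)

text \<open>Neighbours outside \<Omega> contribute zero; this is how the Dirichlet condition enters
  sums taken over \<Omega>.\<close>

lemma sum_adjacent_supported: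
  assumes "finite \<Omega>" "\<And>y. y \<notin> \<Omega> \<Longrightarrow> f y = 0"
  shows "(\<Sum>y\<in>\<Omega>. if adjacent x y then f y else 0) = neighbour_sum f x"
proof -
  have "(\<Sum>y\<in>\<Omega>. if adjacent x y then f y else 0) = (\<Sum>y\<in>\<Omega> \<inter> {y. adjacent x y}. f y)"
    using assms(1) by (simp add: sum.inter_restrict)
  also have "\<dots> = (\<Sum>y | adjacent x y. f y)"
    using assms(2) by (intro sum.mono_neutral_left finite_adjacent) auto
  finally show ?thesis
    by (simp add: sum_adjacent)
qed

text \<open>The matrix of the negative Laplacian on the whole lattice; restricting both arguments to
  \<Omega> gives the Dirichlet operator.\<close>

definition lattice_kernel :: "int ^ 'n \<Rightarrow> int ^ 'n \<Rightarrow> real"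
  where "lattice_kernel x y =
    (if x = y then 1 else 0) - (if adjacent x y then 1 / (2 * real CARD('n)) else 0)"

lemma sum_lattice_kernel:
  fixes \<Omega> :: "(int ^ 'n) set"
  assumes "finite \<Omega>" "x \<in> \<Omega>" "\<And>y. y \<notin> \<Omega> \<Longrightarrow> f y = 0"
  shows "(\<Sum>y\<in>\<Omega>. lattice_kernel x y * f y) = f x - neighbour_sum f x / (2 * real CARD('n))"
proof -
  have "(\<Sum>y\<in>\<Omega>. lattice_kernel x y * f y)
      = (\<Sum>y\<in>\<Omega>. (if x = y then f y else 0)
          - (if adjacent x y then f y else 0) / (2 * real CARD('n)))"
    by (intro sum.cong) (auto simp: lattice_kernel_def algebra_simps)
  also have "\<dots> = f x - neighbour_sum f x / (2 * real CARD('n))"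
    using assms by (simp add: sum_subtractf sum_adjacent_supported flip: sum_divide_distrib)
  finally show ?thesis .
qed

lemma symmetric_lattice_kernel: "finite \<Omega> \<Longrightarrow> symmetric_kernel \<Omega> lattice_kernel"
  by unfold_locales (auto simp: lattice_kernel_def adjacent_commute)

text \<open>For functions vanishing off \<Omega> the extension by zero changes nothing, so the
  operators agree on \<Omega>, while off \<Omega> both sides of the kernel equation are
  zero.\<close>

lemma dirichlet_eigenspace_eq:
  fixes \<Omega> :: "(int ^ 'n) set"
  assumes "finite \<Omega>"
  shows "dirichlet_eigenspace \<Omega> \<mu> = symmetric_kernel.eigen \<Omega> lattice_kernel \<mu>"
proof -
  interpret symmetric_kernel \<Omega> lattice_kernel
    using assms by (rule symmetric_lattice_kernel)
  have "- dirichlet_laplacian \<Omega> f x = app f x" if f: "\<forall>x. x \<notin> \<Omega> \<longrightarrow> f x = 0" and x: "x \<in> \<Omega>" for f x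
  proof -
    have "extend_by_zero \<Omega> f = f"
      using f by (auto simp: extend_by_zero_def)
    then show ?thesis
      using f x assms
      by (simp add: dirichlet_laplacian_def laplacian_def sum_adjacent vertex_degree_eq
          app_def sum_lattice_kernel)
  qed
  then show ?thesis
    by (auto simp: dirichlet_eigenspace_def eigen_def supported_def fun_eq_iff) (auto simp: app_def)
qed

text \<open>The shifted sum runs over a translate of \<Omega>, in which only the points of \<Omega>
  contribute.\<close>

lemma sum_shift_squares_le:
  fixes f :: "'a::ab_group_add \<Rightarrow> real"
  assumes "finite \<Omega>" "\<And>x. x \<notin> \<Omega> \<Longrightarrow> f x = 0"
  shows "(\<Sum>x\<in>\<Omega>. (f (x + v))\<^sup>2) \<le> (\<Sum>x\<in>\<Omega>. (f x)\<^sup>2)"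
proof -
  have "(\<Sum>x\<in>\<Omega>. (f (x + v))\<^sup>2) = (\<Sum>x\<in>(\<lambda>x. x + v) ` \<Omega>. (f x)\<^sup>2)"
    by (simp add: sum.reindex inj_on_def)
  also have "\<dots> \<le> (\<Sum>x\<in>(\<lambda>x. x + v) ` \<Omega> \<union> \<Omega>. (f x)\<^sup>2)"
    using assms(1) by (intro sum_mono2) auto
  also have "\<dots> = (\<Sum>x\<in>\<Omega>. (f x)\<^sup>2)"
    using assms by (intro sum.mono_neutral_right) auto
  finally show ?thesis .
qed

text \<open>\<open>(a - b)\<^sup>2 \<le> 2 (a - c)\<^sup>2 + 2 (c - b)\<^sup>2\<close>, with \<open>c\<close> the value at the centre.\<close>

lemma central_difference_bound:
  fixes f :: "int ^ 'n \<Rightarrow> real"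
  assumes "finite \<Omega>" "\<And>x. x \<notin> \<Omega> \<Longrightarrow> f x = 0"
  shows "(\<Sum>i\<in>UNIV. \<Sum>x\<in>\<Omega>. (f (x + axis i 1) - f (x - axis i 1))\<^sup>2)
    \<le> 8 * real CARD('n) * (\<Sum>x\<in>\<Omega>. (f x)\<^sup>2) - 4 * (\<Sum>x\<in>\<Omega>. f x * neighbour_sum f x)"
proof -
  define N where "N = (\<Sum>x\<in>\<Omega>. (f x)\<^sup>2)"
  have pt: "(a - b)\<^sup>2 \<le> 2 * a\<^sup>2 + 2 * b\<^sup>2 + 4 * c\<^sup>2 - 4 * (c * (a + b))" for a b c :: real
  proof -
    have "0 \<le> (a + b - 2 * c)\<^sup>2"
      by simp
    then show ?thesis
      by (simp add: power2_eq_square algebra_simps)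
  qed
  have "(\<Sum>i\<in>UNIV. \<Sum>x\<in>\<Omega>. (f (x + axis i 1) - f (x - axis i 1))\<^sup>2)
      \<le> (\<Sum>i\<in>(UNIV :: 'n set). 8 * N - 4 * (\<Sum>x\<in>\<Omega>. f x * (f (x + axis i 1) + f (x - axis i 1))))"
  proof (rule sum_mono)
    fix i :: 'n
    have "(\<Sum>x\<in>\<Omega>. (f (x + axis i 1) - f (x - axis i 1))\<^sup>2)
        \<le> (\<Sum>x\<in>\<Omega>. 2 * (f (x + axis i 1))\<^sup>2 + 2 * (f (x - axis i 1))\<^sup>2 + 4 * (f x)\<^sup>2
            - 4 * (f x * (f (x + axis i 1) + f (x - axis i 1))))"
      by (intro sum_mono pt)
    also have "\<dots> = 2 * (\<Sum>x\<in>\<Omega>. (f (x + axis i 1))\<^sup>2) + 2 * (\<Sum>x\<in>\<Omega>. (f (x + - axis i 1))\<^sup>2) + 4 * N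
            - 4 * (\<Sum>x\<in>\<Omega>. f x * (f (x + axis i 1) + f (x - axis i 1)))"
      by (simp add: N_def sum.distrib sum_subtractf sum_distrib_left)
    \<comment> \<open>Each shifted sum of squares is at most \<open>N\<close>, so the square terms
      add up to at most \<open>2 N + 2 N + 4 N\<close>.\<close>
    also have "\<dots> \<le> 8 * N - 4 * (\<Sum>x\<in>\<Omega>. f x * (f (x + axis i 1) + f (x - axis i 1)))"
      using sum_shift_squares_le[where f = f, OF assms, where v = "axis i 1"]
        sum_shift_squares_le[where f = f, OF assms, where v = "- axis i 1"]
      unfolding N_def by linarith
    finally show "(\<Sum>x\<in>\<Omega>. (f (x + axis i 1) - f (x - axis i 1))\<^sup>2)
        \<le> 8 * N - 4 * (\<Sum>x\<in>\<Omega>. f x * (f (x + axis i 1) + f (x - axis i 1)))" .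
  qed
  also have "\<dots> = 8 * real CARD('n) * N
      - 4 * (\<Sum>i\<in>(UNIV :: 'n set). \<Sum>x\<in>\<Omega>. f x * (f (x + axis i 1) + f (x - axis i 1)))"
    unfolding sum_subtractf sum_distrib_left[symmetric] by simp
  also have "(\<Sum>i\<in>(UNIV :: 'n set). \<Sum>x\<in>\<Omega>. f x * (f (x + axis i 1) + f (x - axis i 1)))
      = (\<Sum>x\<in>\<Omega>. f x * neighbour_sum f x)"
    unfolding neighbour_sum_def sum_distrib_left by (rule sum.swap)
  finally show ?thesis
    by (simp add: N_def)
qed

section \<open>Commutators of the coordinate functions on a normalised eigenfunction\<close>

context
  fixes \<Omega> :: "(int ^ 'n) set" and \<mu> :: real and b
  assumes fin: "finite \<Omega>"
    and b: "b \<in> symmetric_kernel.eigen \<Omega> lattice_kernel \<mu>"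
    and unit: "symmetric_kernel.ip \<Omega> b b = 1"
begin

interpretation symmetric_kernel \<Omega> lattice_kernel
  using fin by (rule symmetric_lattice_kernel)

lemma supp_b: "x \<notin> \<Omega> \<Longrightarrow> b x = 0"
  using b by (simp add: eigen_def supported_def)

lemma sum_squares_b: "(\<Sum>x\<in>\<Omega>. (b x)\<^sup>2) = 1"
  using unit by (simp add: ip_def power2_eq_square)

text \<open>On \<Omega> the eigenvalue equation says that the neighbour sum is
  \<open>2 n (1 - \<mu>)\<close> times \<open>b\<close>, and \<open>b\<close> has norm 1.\<close>

lemma neighbour_sum_form: "(\<Sum>x\<in>\<Omega>. b x * neighbour_sum b x) = 2 * real CARD('n) * (1 - \<mu>)"
proof -
  have "neighbour_sum b x = 2 * real CARD('n) * (1 - \<mu>) * b x" if "x \<in> \<Omega>" for x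
  proof -
    have "app b x = \<mu> * b x"
      using b by (simp add: eigen_def)
    then have "b x - neighbour_sum b x / (2 * real CARD('n)) = \<mu> * b x"
      using that by (simp add: app_def sum_lattice_kernel[OF fin that supp_b])
    then show ?thesis
      by (simp add: field_simps)
  qed
  then have "(\<Sum>x\<in>\<Omega>. b x * neighbour_sum b x)
      = (\<Sum>x\<in>\<Omega>. 2 * real CARD('n) * (1 - \<mu>) * (b x)\<^sup>2)"
    by (intro sum.cong) (auto simp: power2_eq_square)
  then show ?thesis
    using sum_squares_b by (simp flip: sum_distrib_left)
qed

text \<open>Summing over \<open>i\<close> first leaves \<open>1 / (2 n)\<close> on edges and nothing
  on the diagonal, hence the form of the averaging operator, whose value at \<open>b\<close> is
  \<open>1 - \<mu>\<close>.\<close>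

lemma double_commutator_sum:
  "(\<Sum>i\<in>UNIV. \<Sum>x\<in>\<Omega>. \<Sum>y\<in>\<Omega>.
      - lattice_kernel x y * (real_of_int (x $ i) - real_of_int (y $ i))\<^sup>2 * b x * b y) = 1 - \<mu>"
proof -
  let ?d = "\<lambda>x y i. (real_of_int (x $ i) - real_of_int (y $ i))\<^sup>2"
  have k: "(\<Sum>i\<in>UNIV. - lattice_kernel x y * ?d x y i * b x * b y)
      = b x * (if adjacent x y then b y else 0) / (2 * real CARD('n))" for x y
  proof -
    have "(\<Sum>i\<in>UNIV. - lattice_kernel x y * ?d x y i * b x * b y)
        = - lattice_kernel x y * (\<Sum>i\<in>UNIV. ?d x y i) * b x * b y"
      unfolding sum_distrib_left sum_distrib_right ..
    also have "\<dots> = b x * (if adjacent x y then b y else 0) / (2 * real CARD('n))"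
      by (auto simp: lattice_kernel_def adjacent_sum_squares not_adjacent_self)
    finally show ?thesis .
  qed
  have "(\<Sum>i\<in>UNIV. \<Sum>x\<in>\<Omega>. \<Sum>y\<in>\<Omega>. - lattice_kernel x y * ?d x y i * b x * b y)
      = (\<Sum>x\<in>\<Omega>. \<Sum>i\<in>UNIV. \<Sum>y\<in>\<Omega>. - lattice_kernel x y * ?d x y i * b x * b y)"
    by (rule sum.swap)
  also have "\<dots> = (\<Sum>x\<in>\<Omega>. \<Sum>y\<in>\<Omega>. \<Sum>i\<in>UNIV. - lattice_kernel x y * ?d x y i * b x * b y)"
    by (intro sum.cong refl sum.swap)
  also have "\<dots> = (\<Sum>x\<in>\<Omega>. b x * (\<Sum>y\<in>\<Omega>. if adjacent x y then b y else 0)) / (2 * real CARD('n))"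
    unfolding k by (simp add: sum_distrib_left sum_divide_distrib)
  also have "\<dots> = 1 - \<mu>"
    by (simp add: sum_adjacent_supported[OF fin supp_b] neighbour_sum_form)
  finally show ?thesis .
qed

text \<open>Each commutator is, up to sign, a central difference divided by \<open>2 n\<close>. The
  bound on central differences then gives
  \<open>(8 n - 8 n (1 - \<mu>)) / (2 n)\<^sup>2 = 2 \<mu> / n\<close>.\<close>

lemma commutator_norm_le:
  "(\<Sum>i\<in>UNIV. \<Sum>x\<in>\<Omega>.
      (\<Sum>y\<in>\<Omega>. lattice_kernel x y * (real_of_int (y $ i) - real_of_int (x $ i)) * b y)\<^sup>2)
    \<le> 2 * \<mu> / real CARD('n)"
proof -
  let ?c = "2 * real CARD('n)"
  have D: "(\<Sum>y\<in>\<Omega>. lattice_kernel x y * (real_of_int (y $ i) - real_of_int (x $ i)) * b y)\<^sup>2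
      = (b (x + axis i 1) - b (x - axis i 1))\<^sup>2 / ?c\<^sup>2" if x: "x \<in> \<Omega>" for x i
  proof -
    let ?f = "\<lambda>y. (real_of_int (y $ i) - real_of_int (x $ i)) * b y"
    \<comment> \<open>The factor \<open>y $ i - x $ i\<close> is 1 and -1 at the two neighbours in
      direction \<open>i\<close> and 0 at the others; it also vanishes at \<open>x\<close>, which
      removes the diagonal term.\<close>
    have "neighbour_sum ?f x = (\<Sum>j\<in>UNIV. if j = i then b (x + axis j 1) - b (x - axis j 1) else 0)"
      unfolding neighbour_sum_def by (intro sum.cong) (auto simp: axis_def)
    then have "neighbour_sum ?f x = b (x + axis i 1) - b (x - axis i 1)"
      by simp
    then show ?thesis
      using sum_lattice_kernel[OF fin x, of ?f] supp_b
      by (simp add: mult.assoc power_divide)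
  qed
  have "(\<Sum>i\<in>UNIV. \<Sum>x\<in>\<Omega>.
      (\<Sum>y\<in>\<Omega>. lattice_kernel x y * (real_of_int (y $ i) - real_of_int (x $ i)) * b y)\<^sup>2)
    = (\<Sum>i\<in>UNIV. \<Sum>x\<in>\<Omega>. (b (x + axis i 1) - b (x - axis i 1))\<^sup>2) / ?c\<^sup>2"
    unfolding sum_divide_distrib by (intro sum.cong refl D)
  also have "\<dots> \<le> (8 * real CARD('n) - 4 * (?c * (1 - \<mu>))) / ?c\<^sup>2"
    using central_difference_bound[of \<Omega> b, OF fin supp_b] sum_squares_b neighbour_sum_form
    by (intro divide_right_mono) auto
  also have "\<dots> = 2 * \<mu> / real CARD('n)"
    by (simp add: field_simps power2_eq_square)
  finally show ?thesis .
qed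

end

section \<open>Summation over the coordinates and the lowest eigenfunctions\<close>

theorem theorem1p3:
  fixes \<Omega> :: "(int ^ 'n) set" and k :: nat
  assumes "finite \<Omega>"
    and "1 \<le> k" and "k \<le> card \<Omega> - 1"
  defines "lam \<equiv> dirichlet_eigenvalue \<Omega>"
  shows "(if lam (k + 1) = lam k then \<infinity>
          else ereal (\<Sum>i = 1..k. lam i / (lam (k + 1) - lam i)))
         \<ge> ereal (real CARD('n) / 4 * (\<Sum>i = 1..k. 1 - lam i))"
proof (cases "lam (k + 1) = lam k")
  case True
  then show ?thesis
    by simp
next
  case False
  interpret symmetric_kernel \<Omega> lattice_kernel
    using assms(1) by (rule symmetric_lattice_kernel)
  obtain bs ev where eb: "eigenbasis (set bs) ev" and bs: "distinct bs" "length bs = card \<Omega>"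
    and sorted: "sorted (map ev bs)"
    and list: "concat (map (\<lambda>\<mu>. replicate (real_fun.dim (eigen \<mu>)) \<mu>)
      (sorted_list_of_set {\<mu>. \<exists>f\<in>eigen \<mu>. f \<noteq> (\<lambda>x. 0)})) = map ev bs"
    by (rule eigenvalue_list)
  have "dirichlet_eigenvalue_list \<Omega> = map ev bs"
    using list by (simp add: dirichlet_eigenvalue_list_def dirichlet_spectrum_def
        dirichlet_multiplicity_def dirichlet_eigenspace_eq[OF assms(1)])
  then have lam: "lam (Suc i) = ev (bs ! i)" if "i < card \<Omega>" for i
    using that bs(2) by (simp add: lam_def dirichlet_eigenvalue_def)
  \<comment> \<open>Subtraction is truncated, but \<open>1 \<le> k\<close> rules out the case
    \<open>card \<Omega> = 0\<close>.\<close>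
  have k: "k < card \<Omega>"
    using assms by simp
  have mono: "ev (bs ! i) \<le> ev (bs ! j)" if "i \<le> j" "j < card \<Omega>" for i j
    using sorted_nth_mono[OF sorted, of i j] that bs(2) by simp
  \<comment> \<open>Positions in \<open>bs\<close> start at 0 and eigenvalue indices at 1:
    \<open>S\<close> holds the first \<open>k\<close> basis vectors, and position \<open>k\<close>
    carries the eigenvalue with index \<open>k + 1\<close>.\<close>
  define S where "S = (!) bs ` {..<k}"
  define \<Lambda> where "\<Lambda> = ev (bs ! k)"
  have S: "S \<subseteq> set bs"
    using k bs(2) by (auto simp: S_def)
  have inj: "inj_on ((!) bs) {..<k}"
    using k bs by (auto simp: inj_on_def nth_eq_iff_index_eq)
  have sum_S: "(\<Sum>b\<in>S. h (ev b)) = (\<Sum>i = 1..k. h (lam i))" for h :: "real \<Rightarrow> real"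
  proof -
    have "(\<Sum>b\<in>S. h (ev b)) = (\<Sum>i<k. h (lam (Suc i)))"
      unfolding S_def sum.reindex[OF inj] using k lam by (intro sum.cong) auto
    also have "\<dots> = (\<Sum>i = 1..k. h (lam i))"
      by (simp add: sum.atLeast1_atMost_eq)
    finally show ?thesis .
  qed
  \<comment> \<open>Sortedness together with the case assumption gives a strict gap, which makes
    every denominator positive.\<close>
  have gap: "ev (bs ! (k - 1)) < \<Lambda>"
    using False mono[of "k - 1" k] lam[of k] lam[of "k - 1"] k assms(2)
    by (auto simp: \<Lambda>_def)
  have low: "ev b < \<Lambda>" if b: "b \<in> S" for b
  proof -
    obtain i where "i < k" "b = bs ! i"
      using b by (auto simp: S_def)
    then show ?thesis
      using mono[of i "k - 1"] gap k by fastforce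
  qed
  have high: "\<Lambda> \<le> ev c" if c: "c \<in> set bs - S" for c
  proof -
    obtain i where i: "i < length bs" "c = bs ! i"
      using c by (auto simp: in_set_conv_nth)
    then have "k \<le> i"
      using c by (auto simp: S_def not_less[symmetric])
    then show ?thesis
      using mono[of k i] i bs(2) by (simp add: \<Lambda>_def)
  qed
  have unit: "b \<in> eigen (ev b)" "ip b b = 1" if "b \<in> S" for b
    using that S eb by (auto simp: eigenbasis_def orthonormal_def)
  let ?n = "real CARD('n)"
  let ?Q = "\<lambda>i b. \<Sum>x\<in>\<Omega>. \<Sum>y\<in>\<Omega>.
    - lattice_kernel x y * (real_of_int (x $ i) - real_of_int (y $ i))\<^sup>2 * b x * b y"
  let ?C = "\<lambda>i b. \<Sum>x\<in>\<Omega>.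
    (\<Sum>y\<in>\<Omega>. lattice_kernel x y * (real_of_int (y $ i) - real_of_int (x $ i)) * b y)\<^sup>2"
  have "(\<Sum>b\<in>S. 1 - ev b) = (\<Sum>b\<in>S. \<Sum>i\<in>UNIV. ?Q i b)"
    using double_commutator_sum[OF assms(1) unit] by (intro sum.cong) auto
  also have "\<dots> = (\<Sum>i\<in>UNIV. \<Sum>b\<in>S. ?Q i b)"
    by (rule sum.swap)
  \<comment> \<open>One instance of the commutator inequality per direction, with \<open>g\<close>
    the coordinate function \<open>\<lambda>x. real_of_int (x $ i)\<close>.\<close>
  also have "\<dots> \<le> (\<Sum>i\<in>UNIV. 2 * (\<Sum>b\<in>S. ?C i b / (\<Lambda> - ev b)))"
    by (intro sum_mono commutator_inequality[OF eb S low high])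
  also have "\<dots> = 2 * (\<Sum>b\<in>S. \<Sum>i\<in>UNIV. ?C i b / (\<Lambda> - ev b))"
    unfolding sum_distrib_left[symmetric] by (subst sum.swap) (rule refl)
  also have "\<dots> = 2 * (\<Sum>b\<in>S. (\<Sum>i\<in>UNIV. ?C i b) / (\<Lambda> - ev b))"
    unfolding sum_divide_distrib ..
  \<comment> \<open>The norm bound \<open>2 * ev b / n\<close> and the outer factor 2 combine to the
    constant \<open>4 / n\<close>.\<close>
  also have "\<dots> \<le> 2 * (\<Sum>b\<in>S. (2 * ev b / ?n) / (\<Lambda> - ev b))"
    using commutator_norm_le[OF assms(1) unit] low
    by (intro mult_left_mono sum_mono divide_right_mono) (auto simp: less_imp_le)
  also have "\<dots> = 4 / ?n * (\<Sum>b\<in>S. ev b / (\<Lambda> - ev b))"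
    by (simp add: sum_distrib_left)
  finally have "?n / 4 * (\<Sum>b\<in>S. 1 - ev b) \<le> (\<Sum>b\<in>S. ev b / (\<Lambda> - ev b))"
    by (simp add: field_simps)
  moreover have "lam (k + 1) = \<Lambda>"
    using lam[OF k] by (simp add: \<Lambda>_def)
  ultimately show ?thesis
    using False sum_S[of "\<lambda>t. 1 - t"] sum_S[of "\<lambda>t. t / (\<Lambda> - t)"] by simp
qed

end
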